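(* Let $q$ be a positive integer and let $r$ be an integer with $0\leq r < 2^{q^2}$. Then for $m=2^{3q^2}+r$, $$\alpha(m) \leq (q+1) \lceil \log_2 q \rceil+4q+6.$$
   Context: For a finite family $\mathcal{S}=\{S_1,\dots,S_t\}$ of finite sets, $\mathbf{ID}(\mathcal{S})=2^{S_1}\cup\cdots\cup 2^{S_t}$ (all sets contained in some member of $\mathcal{S}$). For a positive integer $k$, $\alpha(k)$ is the minimum of $|\mathcal{S}|$ over all finite families $\mathcal{S}$ of finite sets with $|\mathbf{ID}(\mathcal{S})|=k$. *)

theory Defs
  imports Complex_Main
begin

definition ID :: "'a set set \<Rightarrow> 'a set set" where
  "ID S = (\<Union>A\<in>S. Pow A)"

text \<open>
  The ground set is taken to be \<^typ>\<open>nat\<close>. This loses no generality, since a finite family of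
  finite sets over any type can be relabelled injectively by natural numbers, see
  \<open>alpha_le\<close>. The minimum exists for every positive \<open>k\<close>, see \<open>alpha_attained\<close>.
\<close>

definition alpha :: "nat \<Rightarrow> nat" where
  "alpha k = (LEAST t. \<exists>S :: nat set set.
     finite S \<and> (\<forall>A\<in>S. finite A) \<and> card (ID S) = k \<and> card S = t)"

lemma alpha_attained:
  assumes "k > 0"
  shows "\<exists>S :: nat set set.
    finite S \<and> (\<forall>A\<in>S. finite A) \<and> card (ID S) = k \<and> card S = alpha k"
proof -
  let ?S = "insert {} ((\<lambda>i. {i}) ` {..<k - 1}) :: nat set set"
  have "ID ?S = ?S"
    by (auto simp: ID_def)
  moreover have "card ?S = k"
    using assms by (subst card_insert_disjoint) (auto simp: card_image)
  ultimately have "\<exists>t. \<exists>S :: nat set set.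
      finite S \<and> (\<forall>A\<in>S. finite A) \<and> card (ID S) = k \<and> card S = t"
    by (intro exI[of _ k] exI[of _ ?S]) auto
  then show ?thesis
    unfolding alpha_def by (rule LeastI_ex)
qed

lemma alpha_le:
  fixes S :: "'a set set"
  assumes "finite S" and "\<And>A. A \<in> S \<Longrightarrow> finite A"
  shows "alpha (card (ID S)) \<le> card S"
proof -
  have "finite (\<Union>S)"
    using assms by auto
  then obtain f :: "'a \<Rightarrow> nat" where f: "inj_on f (\<Union>S)"
    using finite_imp_inj_to_nat_seg by blast
  have inj: "inj_on ((`) f) (Pow (\<Union>S))"
    using f by (rule inj_on_image_Pow)
  have "ID ((`) f ` S) = (`) f ` ID S"
    by (simp add: ID_def image_UN image_Pow_surj[OF refl])
  moreover have "card ((`) f ` ID S) = card (ID S)"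
    by (rule card_image, rule inj_on_subset[OF inj]) (auto simp: ID_def)
  moreover have "card ((`) f ` S) = card S"
    by (rule card_image, rule inj_on_subset[OF inj]) auto
  ultimately show ?thesis
    unfolding alpha_def using assms
    by (intro Least_le exI[of _ "(`) f ` S"]) auto
qed

end

theory Submission imports Defs begin

text \<open>
  Take \<open>q\<close> sets \<open>A j\<close> that pairwise meet in a common core of size \<open>q\<^sup>2\<close>, and \<open>q\<close> further sets
  \<open>Y i\<close> that pairwise meet inside that core, where \<open>Y i\<close> contains \<open>q * i\<close> points of the core and
  \<open>j\<close> or \<open>j + 1\<close> private points of \<open>A j\<close>, depending on the bit \<open>q * i + j\<close> of a number
  \<open>s < 2 ^ q\<^sup>2\<close>. Each \<open>Y i\<close> adds \<open>2 ^ card (Y i)\<close> sets to the ideal, except for those already below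
  some \<open>A j\<close>; the total number of exceptions is a constant plus \<open>s\<close>. The \<open>2 * q\<close> sets are padded
  to the distinct sizes \<open>3 * q\<^sup>2 - 1, \<dots>, 3 * q\<^sup>2 - 2 * q\<close>, so that together with one more set
  the powers of two sum to \<open>2 ^ (3 * q\<^sup>2)\<close>. The remaining constant is
  corrected by \<open>q\<close> or \<open>q + 1\<close> sets that contribute \<open>2 ^ q\<^sup>2\<close> each, and \<open>s\<close> is chosen accordingly.
  This uses at most \<open>3 * q + 2\<close> sets.
\<close>

section \<open>Cardinalities of unions of power sets\<close>

lemma finite_ID: "finite S \<Longrightarrow> (\<And>A. A \<in> S \<Longrightarrow> finite A) \<Longrightarrow> finite (ID S)"
  by (auto simp: ID_def)

lemma ID_Un: "ID (S \<union> T) = ID S \<union> ID T"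
  by (auto simp: ID_def)

lemma ID_image: "ID (f ` K) = (\<Union>i\<in>K. Pow (f i))"
  by (auto simp: ID_def)

lemma ID_Int_Pow: "ID S \<inter> Pow Y = ID ((\<lambda>A. A \<inter> Y) ` S)"
  by (auto simp: ID_def)

text \<open>All overlaps among the \<open>P i\<close> lie in \<open>I\<close>, so adjoining
  \<open>P k\<close> to the union built so far loses exactly \<open>card (I \<inter> P k)\<close>.
  The identity is additive to avoid truncated subtraction.\<close>

lemma card_Un_UN_Int_subset:
  assumes "finite K" "finite I" "\<And>i. i \<in> K \<Longrightarrow> finite (P i)"
    and "\<And>i k. i \<in> K \<Longrightarrow> k \<in> K \<Longrightarrow> i \<noteq> k \<Longrightarrow> P i \<inter> P k \<subseteq> I"
  shows "card (I \<union> (\<Union>i\<in>K. P i)) + (\<Sum>i\<in>K. card (I \<inter> P i)) = card I + (\<Sum>i\<in>K. card (P i))"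
  using assms
proof (induction K rule: finite_induct)
  case (insert k K)
  let ?U = "I \<union> (\<Union>i\<in>K. P i)"
  have "?U \<inter> P k = I \<inter> P k"
  proof -
    have "P i \<inter> P k \<subseteq> I" if "i \<in> K" for i
      using that insert.hyps(2) by (intro insert.prems(3)) auto
    then show ?thesis
      by blast
  qed
  moreover have "card ?U + card (P k) = card (?U \<union> P k) + card (?U \<inter> P k)"
    using insert.prems insert.hyps by (intro card_Un_Int) auto
  moreover have "I \<union> (\<Union>i\<in>insert k K. P i) = ?U \<union> P k"
    by auto
  moreover have "card ?U + (\<Sum>i\<in>K. card (I \<inter> P i)) = card I + (\<Sum>i\<in>K. card (P i))"
    using insert.prems by (intro insert.IH) auto
  ultimately show ?case
    using insert.hyps by simp
qed simp

text \<open>The power sets of the \<open>A j\<close> overlap only inside \<open>Pow C\<close>, so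
  each \<open>A j\<close> contributes \<open>2 ^ card (A j) - 2 ^ card C\<close> sets beyond
  \<open>Pow C\<close>.\<close>

lemma card_ID_sunflower:
  assumes "finite K" "K \<noteq> {}" "\<And>j. j \<in> K \<Longrightarrow> finite (A j)"
    and core: "\<And>j. j \<in> K \<Longrightarrow> C \<subseteq> A j"
    and "\<And>i j. i \<in> K \<Longrightarrow> j \<in> K \<Longrightarrow> i \<noteq> j \<Longrightarrow> A i \<inter> A j \<subseteq> C"
  shows "card (ID (A ` K)) + card K * 2 ^ card C = 2 ^ card C + (\<Sum>j\<in>K. 2 ^ card (A j))"
proof -
  have "finite C"
    using \<open>K \<noteq> {}\<close> assms(3) core by (meson all_not_in_conv finite_subset)
  have "card (Pow C \<union> (\<Union>j\<in>K. Pow (A j))) + (\<Sum>j\<in>K. card (Pow C \<inter> Pow (A j)))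
      = card (Pow C) + (\<Sum>j\<in>K. card (Pow (A j)))"
  proof (rule card_Un_UN_Int_subset)
    show "Pow (A i) \<inter> Pow (A j) \<subseteq> Pow C" if "i \<in> K" "j \<in> K" "i \<noteq> j" for i j
      using assms(5)[OF that] by auto
  qed (use assms(1,3) \<open>finite C\<close> in auto)
  moreover have "Pow C \<union> (\<Union>j\<in>K. Pow (A j)) = ID (A ` K)"
    using core \<open>K \<noteq> {}\<close> by (auto simp: ID_image)
  moreover have "(\<Sum>j\<in>K. card (Pow C \<inter> Pow (A j))) = (\<Sum>j\<in>K. 2 ^ card C)"
    using core \<open>finite C\<close> by (intro sum.cong) (simp_all add: Int_absorb2 Pow_mono card_Pow)
  moreover have "(\<Sum>j\<in>K. card (Pow (A j))) = (\<Sum>j\<in>K. 2 ^ card (A j))"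
    using assms(3) by (intro sum.cong) (auto simp: card_Pow)
  ultimately show ?thesis
    using \<open>finite C\<close> by (simp add: card_Pow)
qed

section \<open>Adding powers of two, one set each\<close>

text \<open>Join a fresh point \<open>y\<close> to an \<open>a\<close>-element subset of
  \<open>A\<close>: the new sets in the ideal are exactly those containing \<open>y\<close>. Keeping
  \<open>A\<close> in the family lets the step be iterated.\<close>

lemma add_power_of_two:
  fixes S :: "'a set set"
  assumes "infinite (UNIV :: 'a set)" and fin: "finite S" "\<And>B. B \<in> S \<Longrightarrow> finite B"
    and "A \<in> S" "a \<le> card A"
  obtains T where "finite T" "\<And>B. B \<in> T \<Longrightarrow> finite B" "A \<in> T" "card T \<le> card S + 1"
    "card (ID T) = card (ID S) + 2 ^ a"
proof -
  obtain B where B: "B \<subseteq> A" "card B = a" "finite B"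
    using \<open>a \<le> card A\<close> obtain_subset_with_card_n by blast
  have "finite (\<Union>S)"
    using fin by auto
  then obtain y where y: "y \<notin> \<Union>S"
    using assms(1) ex_new_if_finite by blast
  have "y \<notin> B"
    using y B \<open>A \<in> S\<close> by auto
  have "Pow B \<subseteq> ID S"
    using B(1) \<open>A \<in> S\<close> by (auto simp: ID_def)
  then have ID: "ID (insert (insert y B) S) = ID S \<union> insert y ` Pow B"
    by (auto simp: ID_def Pow_insert)
  have "ID S \<inter> insert y ` Pow B = {}"
    using y by (auto simp: ID_def)
  moreover have "card (insert y ` Pow B) = 2 ^ a"
    using B \<open>y \<notin> B\<close> by (subst card_image) (auto simp: card_Pow inj_on_def)
  ultimately have "card (ID (insert (insert y B) S)) = card (ID S) + 2 ^ a"
    unfolding ID using B finite_ID[of S] fin by (subst card_Un_disjoint) auto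
  then show ?thesis
    using fin B \<open>A \<in> S\<close> by (intro that[of "insert (insert y B) S"]) (auto intro: card_insert_le_m1)
qed

lemma alpha_add_powers_of_two_le:
  fixes S :: "'a set set"
  assumes "infinite (UNIV :: 'a set)" "finite S" "\<And>B. B \<in> S \<Longrightarrow> finite B"
    and "A \<in> S" "\<And>a. a \<in> set as \<Longrightarrow> a \<le> card A"
  shows "alpha (card (ID S) + (\<Sum>a\<leftarrow>as. 2 ^ a)) \<le> card S + length as"
  using assms
proof (induction as arbitrary: S)
  case Nil
  then show ?case
    using alpha_le[of S] by simp
next
  case (Cons a as)
  obtain T where T: "finite T" "\<And>B. B \<in> T \<Longrightarrow> finite B" "A \<in> T" "card T \<le> card S + 1"
    "card (ID T) = card (ID S) + 2 ^ a"
    using add_power_of_two[of S A a] Cons.prems by auto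
  have "alpha (card (ID T) + (\<Sum>a\<leftarrow>as. 2 ^ a)) \<le> card T + length as"
    using T Cons.prems by (intro Cons.IH) auto
  then show ?case
    using T by (simp add: add.assoc)
qed

section \<open>Sums of powers of two and binary digits\<close>

lemma sum_blocks:
  fixes f :: "nat \<Rightarrow> nat"
  shows "(\<Sum>i<n. \<Sum>j<k. f (k * i + j)) = (\<Sum>l<n * k. f l)"
proof -
  have "(\<Sum>j<k. f (k * i + j)) = sum f {i * k..<i * k + k}" for i
    using sum.shift_bounds_nat_ivl[of f 0 "i * k" k]
    by (simp add: atLeast0LessThan ac_simps)
  then show ?thesis
    by (simp add: sum.nat_group)
qed

lemma sum_bits: "s < 2 ^ n \<Longrightarrow> (\<Sum>l<n. 2 ^ l * of_bool (bit s l)) = (s :: nat)"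
  using take_bit_sum[of n s]
  by (simp add: take_bit_nat_eq_self push_bit_eq_mult atLeast0LessThan mult.commute)

lemma sum_two_powers: "(\<Sum>l<n. 2 ^ l) + 1 = (2 ^ n :: nat)"
  by (induction n) auto

lemma sum_two_powers_downto:
  "n \<le> N \<Longrightarrow> (\<Sum>k<n. 2 ^ (N - 1 - k)) + 2 ^ (N - n) = (2 ^ N :: nat)"
proof (induction n)
  case (Suc n)
  obtain d where d: "N = Suc n + d"
    using Suc.prems le_Suc_ex by blast
  have "(\<Sum>k<n. 2 ^ (N - 1 - k)) + 2 ^ (N - n) = (2 ^ N :: nat)"
    using Suc by simp
  then show ?case
    by (simp add: d)
qed simp

section \<open>The family encoding a bit pattern\<close>

text \<open>\<open>Petal j i k\<close> is a private point of \<open>A j\<close> available to \<open>Y i\<close>; \<open>PadA\<close> and \<open>PadY\<close> only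
  serve to adjust sizes.\<close>

datatype point = Core nat | Petal nat nat nat | PadA nat nat | PadY nat nat

lemma infinite_point: "infinite (UNIV :: point set)"
proof -
  have "infinite (range Core)"
    using finite_imageD[of Core UNIV] by (auto simp: inj_on_def)
  then show ?thesis
    by (rule infinite_super[OF subset_UNIV])
qed

text \<open>The sets \<open>A j\<close> and \<open>Y i\<close> have the sizes
  \<open>N - 1, ..., N - 2 * q\<close>, whose powers of two miss \<open>2 ^ N\<close> by
  \<open>2 ^ (N - 2 * q)\<close>. The remaining terms count overlaps, and among these only
  \<open>s\<close> depends on the bit pattern.\<close>

lemma bit_pattern_family:
  fixes q s N :: nat
  assumes q: "q > 0" and s: "s < 2 ^ (q * q)" and N: "2 * (q * q) + 2 * q \<le> N"
  obtains S :: "point set set" and B where "finite S" "\<And>A. A \<in> S \<Longrightarrow> finite A"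
    "card S \<le> 2 * q" "B \<in> S" "card B = N - 1"
    "card (ID S) + 2 ^ (N - 2 * q) + q * 2 ^ (q * q) + s
      = 2 ^ N + (q - 1) * (\<Sum>i<q. 2 ^ (q * i)) + 1"
proof -
  \<comment> \<open>A set bit at \<open>l = q * i + j\<close> raises the exponent \<open>l\<close>
    by one, which doubles \<open>2 ^ l\<close> and so adds exactly the contribution of that bit to
    \<open>s\<close>.\<close>
  define e where "e i j = j + of_bool (bit s (q * i + j))" for i j
  define C where "C = Core ` {..<q * q}"
  define A where "A j = C \<union> (\<lambda>(i, k). Petal j i k) ` ({..<q} \<times> {..<q})
    \<union> PadA j ` {..<N - 1 - j - 2 * (q * q)}" for j
  define X where "X i = (\<Union>j<q. Petal j i ` {..<e i j})" for i
  define Y where "Y i = Core ` {..<q * i} \<union> X i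
    \<union> PadY i ` {..<N - 1 - (q + i) - (q * i + card (X i))}" for i
  have e: "e i j \<le> q" if "j < q" for i j
    using that by (auto simp: e_def)
  have qi: "q * i \<le> q * q" if "i < q" for i
    using that by simp
  have card_C: "card C = q * q"
    unfolding C_def by (subst card_image) (auto simp: inj_on_def)
  have finA: "finite (A j)" and finX: "finite (X j)" and finY: "finite (Y j)" for j
    by (auto simp: A_def C_def X_def Y_def)

  have card_A: "card (A j) = N - 1 - j" if "j < q" for j
  proof -
    have "card (A j) = card C + card ((\<lambda>(i, k). Petal j i k) ` ({..<q} \<times> {..<q}))
        + card (PadA j ` {..<N - 1 - j - 2 * (q * q)})"
      unfolding A_def by (subst card_Un_disjoint; (subst card_Un_disjoint)?) (auto simp: C_def)
    also have "\<dots> = q * q + q * q + (N - 1 - j - 2 * (q * q))"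
      by (simp add: card_C card_image inj_on_def)
    finally show ?thesis
      using N that by simp
  qed
  have card_X: "card (X i) \<le> q * q" for i
  proof -
    have "card (X i) \<le> (\<Sum>j<q. card (Petal j i ` {..<e i j}))"
      unfolding X_def by (rule card_UN_le) simp
    also have "\<dots> \<le> (\<Sum>j<q. q)"
      by (intro sum_mono order_trans[OF card_image_le]) (auto simp: e)
    finally show ?thesis
      by simp
  qed
  have card_Y: "card (Y i) = N - 1 - (q + i)" if "i < q" for i
  proof -
    have "card (Y i) = card (Core ` {..<q * i}) + card (X i)
        + card (PadY i ` {..<N - 1 - (q + i) - (q * i + card (X i))})"
      unfolding Y_def using finX[of i]
      by (subst card_Un_disjoint; (subst card_Un_disjoint)?) (auto simp: X_def)
    also have "\<dots> = q * i + card (X i) + (N - 1 - (q + i) - (q * i + card (X i)))"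
      by (simp add: card_image inj_on_def)
    \<comment> \<open>The padding length is not truncated: since \<open>i < q\<close>, the three
      summands are at most \<open>q * q\<close>, \<open>q * q\<close> and
      \<open>2 * q\<close>.\<close>
    moreover have "q * i + card (X i) + (1 + q + i) \<le> N"
      using N that card_X[of i] qi[OF that] by linarith
    ultimately show ?thesis
      by simp
  qed

  let ?A = "A ` {..<q}" and ?Y = "Y ` {..<q}"
  have card_ID_A: "card (ID ?A) + q * 2 ^ (q * q) = 2 ^ (q * q) + (\<Sum>j<q. 2 ^ (N - 1 - j))"
  proof -
    have "card (ID ?A) + card {..<q} * 2 ^ card C = 2 ^ card C + (\<Sum>j<q. 2 ^ card (A j))"
      using q finA by (intro card_ID_sunflower) (auto simp: A_def C_def)
    then show ?thesis
      by (simp add: card_C card_A)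
  qed
  have card_old: "card (ID ?A \<inter> Pow (Y i)) + q * 2 ^ (q * i)
      = 2 ^ (q * i) + (\<Sum>j<q. 2 ^ (q * i + e i j))" if i: "i < q" for i
  proof -
    have AY: "A j \<inter> Y i = Core ` {..<q * i} \<union> Petal j i ` {..<e i j}" if "j < q" for j
    proof (rule set_eqI)
      have "l < q * q" if "l < q * i" for l
        using that qi[OF i] by (rule less_le_trans)
      moreover have "k < q" if "k < e i j" for k
        using that e[OF \<open>j < q\<close>] by (rule less_le_trans)
      ultimately show "x \<in> A j \<inter> Y i \<longleftrightarrow> x \<in> Core ` {..<q * i} \<union> Petal j i ` {..<e i j}" for x
        using i that by (cases x) (auto simp: A_def C_def X_def Y_def simp del: nat_mult_less_cancel_disj)
    qed
    have card_AY: "card (A j \<inter> Y i) = q * i + e i j" if "j < q" for j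
      unfolding AY[OF that] by (subst card_Un_disjoint) (auto simp: card_image inj_on_def)
    have card_core: "card (Core ` {..<q * i}) = q * i"
      by (simp add: card_image inj_on_def)
    have "card (ID ((\<lambda>j. A j \<inter> Y i) ` {..<q})) + card {..<q} * 2 ^ card (Core ` {..<q * i})
        = 2 ^ card (Core ` {..<q * i}) + (\<Sum>j<q. 2 ^ card (A j \<inter> Y i))"
      using q finA by (intro card_ID_sunflower) (auto simp: AY)
    then show ?thesis
      by (simp add: ID_Int_Pow image_image card_core card_AY)
  qed

  have "card (ID ?A \<union> (\<Union>i<q. Pow (Y i))) + (\<Sum>i<q. card (ID ?A \<inter> Pow (Y i)))
      = card (ID ?A) + (\<Sum>i<q. card (Pow (Y i)))"
  proof (intro card_Un_UN_Int_subset)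
    show "Pow (Y i) \<inter> Pow (Y k) \<subseteq> ID ?A" if "i \<in> {..<q}" "k \<in> {..<q}" "i \<noteq> k" for i k
    proof -
      have "Y i \<inter> Y k \<subseteq> C"
        using that less_le_trans[OF _ qi[of i]] by (auto simp: Y_def X_def C_def)
      also have "C \<subseteq> A 0"
        by (auto simp: A_def)
      finally show ?thesis
        using q by (auto simp: ID_def)
    qed
  qed (auto simp: finY finA intro!: finite_ID)
  then have total: "card (ID (?A \<union> ?Y)) + (\<Sum>i<q. card (ID ?A \<inter> Pow (Y i)))
      = card (ID ?A) + (\<Sum>i<q. 2 ^ (N - 1 - (q + i)))"
    by (simp add: ID_Un ID_image card_Pow finY card_Y)

  let ?G = "\<Sum>i<q. 2 ^ (q * i) :: nat"
  have "(\<Sum>i<q. \<Sum>j<q. 2 ^ (q * i + e i j))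
      = (\<Sum>l<q * q. 2 ^ l + 2 ^ l * of_bool (bit s l) :: nat)"
    by (subst sum_blocks[symmetric]) (auto intro!: sum.cong simp: e_def)
  also have "\<dots> = (\<Sum>l<q * q. 2 ^ l) + (\<Sum>l<q * q. 2 ^ l * of_bool (bit s l))"
    by (rule sum.distrib)
  finally have bits: "(\<Sum>i<q. \<Sum>j<q. 2 ^ (q * i + e i j)) + 1 = 2 ^ (q * q) + s"
    using sum_bits[OF s] sum_two_powers[of "q * q"] by simp
  have "(\<Sum>i<q. card (ID ?A \<inter> Pow (Y i)) + q * 2 ^ (q * i))
      = (\<Sum>i<q. 2 ^ (q * i) + (\<Sum>j<q. 2 ^ (q * i + e i j)))"
    by (intro sum.cong) (auto simp: card_old)
  then have old: "(\<Sum>i<q. card (ID ?A \<inter> Pow (Y i))) + q * ?G + 1 = ?G + 2 ^ (q * q) + s"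
    using bits by (simp add: sum.distrib sum_distrib_left)
  have "(\<Sum>j<q. 2 ^ (N - 1 - j)) + (\<Sum>i<q. 2 ^ (N - 1 - (q + i)))
      = (\<Sum>k<2 * q. 2 ^ (N - 1 - k) :: nat)"
  proof -
    have "{..<2} = {0, 1 :: nat}"
      by auto
    then show ?thesis
      using sum_blocks[where f = "\<lambda>k. 2 ^ (N - 1 - k)" and n = 2 and k = q] by simp
  qed
  then have sizes: "(\<Sum>j<q. 2 ^ (N - 1 - j)) + (\<Sum>i<q. 2 ^ (N - 1 - (q + i))) + 2 ^ (N - 2 * q)
      = (2 ^ N :: nat)"
    using sum_two_powers_downto[of "2 * q" N] N by simp
  have qG: "q * g = (q - 1) * g + g" for g
    using q by (cases q) simp_all

  show ?thesis
  proof
    show "finite (?A \<union> ?Y)"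
      by simp
    show "finite B" if "B \<in> ?A \<union> ?Y" for B
      using that finA finY by blast
    have "card (?A \<union> ?Y) \<le> card ?A + card ?Y"
      by (rule card_Un_le)
    also have "\<dots> \<le> card {..<q} + card {..<q}"
      by (intro add_mono card_image_le) simp_all
    finally show "card (?A \<union> ?Y) \<le> 2 * q"
      by simp
    show "A 0 \<in> ?A \<union> ?Y"
      using q by (intro UnI1 imageI) simp
    show "card (A 0) = N - 1"
      using card_A[OF q] by simp
    show "card (ID (?A \<union> ?Y)) + 2 ^ (N - 2 * q) + q * 2 ^ (q * q) + s
        = 2 ^ N + (q - 1) * ?G + 1"
    proof -
      \<comment> \<open>Powers and sums become variables, so that only linear arithmetic remains;
        \<open>w\<close> stands for the number of exceptions and \<open>M\<close> for
        \<open>2 ^ N\<close>.\<close>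
      have "t + p + d + s = M + h + 1"
        if "t + w = a + y" "w + g' + 1 = g + c + s" "a + d = c + x" "x + y + p = M" "g' = h + g"
        for t w a y g g' h c d x p M :: nat
        using that by linarith
      then show ?thesis
        using total old card_ID_A sizes qG .
    qed
  qed
qed

section \<open>Choice of \<open>s\<close> and the linear bound\<close>

lemma alpha_le_linear:
  fixes q r :: nat
  assumes "q > 0" and r: "r < 2 ^ (q * q)"
  shows "alpha (2 ^ (3 * (q * q)) + r) \<le> 3 * q + 2"
proof (cases "q = 1")
  case True
  \<comment> \<open>For \<open>q = 1\<close> the family does not fit, as
    \<open>2 * (q * q) + 2 * q\<close> exceeds \<open>3 * (q * q)\<close>. Here
    \<open>r < 2\<close>, and one 3-element set plus \<open>r\<close> sets contributing
    \<open>2 ^ 0\<close> each suffice.\<close>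
  let ?S = "{{..<3}} :: nat set set"
  have "alpha (card (ID ?S) + (\<Sum>a\<leftarrow>replicate r 0. 2 ^ a)) \<le> card ?S + length (replicate r (0 :: nat))"
    by (rule alpha_add_powers_of_two_le[where A = "{..<3}"]) auto
  then show ?thesis
    using True r by (simp add: ID_def card_Pow sum_list_replicate)
next
  case False
  define N where "N = 3 * (q * q)"
  define H where "H = (q - 1) * (\<Sum>i<q. 2 ^ (q * i)) + 1"
  have "2 * q \<le> q * q"
    using False \<open>q > 0\<close> by simp
  then have N: "2 * (q * q) + 2 * q \<le> N"
    by (simp add: N_def)
  have H: "H < 2 ^ (q * q)"
  proof -
    \<comment> \<open>Replacing \<open>q - 1\<close> by this larger sum turns the product into the
      full geometric sum \<open>2 ^ (q * q) - 1\<close>.\<close>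
    have "q - 1 < (\<Sum>j<q. 2 ^ j)"
      using sum_two_powers[of q] less_exp[of q] \<open>q > 0\<close> by linarith
    moreover have "(\<Sum>i<q. 2 ^ (q * i) :: nat) > 0"
      using \<open>q > 0\<close> by (intro sum_pos) auto
    ultimately have "(q - 1) * (\<Sum>i<q. 2 ^ (q * i)) < (\<Sum>j<q. 2 ^ j) * (\<Sum>i<q. 2 ^ (q * i))"
      by (rule mult_strict_right_mono)
    also have "\<dots> = (\<Sum>i<q. \<Sum>j<q. 2 ^ (q * i + j))"
      by (subst mult.commute) (simp add: sum_product power_add)
    also have "\<dots> = (\<Sum>l<q * q. 2 ^ l)"
      by (rule sum_blocks)
    finally show ?thesis
      using sum_two_powers[of "q * q"] by (simp add: H_def)
  qed
  \<comment> \<open>The correction has to satisfy \<open>H - s + (n - q) * 2 ^ (q * q) = r\<close>,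
    so \<open>s\<close> is the residue of \<open>H - r\<close> modulo \<open>2 ^ (q * q)\<close>,
    and one extra set is spent when \<open>H < r\<close>.\<close>
  define n where "n = q + of_bool (H < r)"
  define s where "s = (if H < r then 2 ^ (q * q) + H - r else H - r)"
  have "s < 2 ^ (q * q)"
    using H by (auto simp: s_def)
  then obtain S :: "point set set" and B where S: "finite S" "\<And>A. A \<in> S \<Longrightarrow> finite A"
      "card S \<le> 2 * q" "B \<in> S" "card B = N - 1"
    and card_S: "card (ID S) + 2 ^ (N - 2 * q) + q * 2 ^ (q * q) + s = 2 ^ N + H"
    using bit_pattern_family[OF \<open>q > 0\<close> _ N, of s] unfolding H_def add.assoc by metis
  have "card (ID S) + (\<Sum>a\<leftarrow>(N - 2 * q) # replicate n (q * q). 2 ^ a)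
      = card (ID S) + 2 ^ (N - 2 * q) + n * 2 ^ (q * q)"
    by (simp add: sum_list_replicate)
  also have "\<dots> = 2 ^ N + r"
    using card_S H r by (cases "H < r") (auto simp: n_def s_def)
  finally have sum: "card (ID S) + (\<Sum>a\<leftarrow>(N - 2 * q) # replicate n (q * q). 2 ^ a) = 2 ^ N + r" .
  have "alpha (card (ID S) + (\<Sum>a\<leftarrow>(N - 2 * q) # replicate n (q * q). 2 ^ a))
      \<le> card S + length ((N - 2 * q) # replicate n (q * q))"
  proof (rule alpha_add_powers_of_two_le[OF infinite_point S(1,2,4)])
    show "a \<le> card B" if "a \<in> set ((N - 2 * q) # replicate n (q * q))" for a
      using that N \<open>q > 0\<close> S(5) by (auto split: if_splits)
  qed
  then show ?thesis
    unfolding sum using S(3) by (simp add: n_def N_def of_bool_def split: if_splits)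
qed

theorem theorem21:
  fixes q r m :: nat
  assumes "q > 0"
    and "r < 2 ^ (q ^ 2)"
    and "m = 2 ^ (3 * q ^ 2) + r"
  shows "int (alpha m) \<le> (int q + 1) * \<lceil>log 2 (real q)\<rceil> + 4 * int q + 6"
proof -
  have "alpha m \<le> 3 * q + 2"
    using alpha_le_linear[of q r] assms by (simp add: power2_eq_square)
  moreover have "log 2 (real q) \<ge> 0"
    using \<open>q > 0\<close> by simp
  then have "(int q + 1) * \<lceil>log 2 (real q)\<rceil> \<ge> 0"
    by (intro mult_nonneg_nonneg) linarith+
  ultimately show ?thesis
    by linarith
qed

end
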